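(* There exists $W\in\mathcal W_{[0,1]}$ for which there is no family of real constants $(a_H)_{H\in\mathcal H}$ such that the series $\sum_{H\in\mathcal H}a_H\,t(H,-)$ is absolutely convergent on $\mathcal W_{[0,1]}$ and equals $C(-,W)$ on $\mathcal W_{[0,1]}$.
   Context: $\mathcal W$ is the vector space of bounded symmetric measurable functions $f:[0,1]^2\to\mathbb R$, and $\mathcal W_{[0,1]}\subset\mathcal W$ the set of those with values in $[0,1]$. $S_{[0,1]}$ is the group of invertible Lebesgue measure-preserving maps of $[0,1]$. The overlay functional is $$C(U,W)=\sup_{\phi\in S_{[0,1]}}\int_{[0,1]^2}U(x,y)\,W(\phi(x),\phi(y))\,dx\,dy,\qquad U,W\in\mathcal W.$$ Multigraphs are finite, undirected, without loops, possibly with multiple edges; an edge $e$ has endpoints $\{e_s,e_t\}$. $\mathcal H_n$ is the set of isomorphism classes of multigraphs with $n$ edges and no isolated vertices; $\mathcal H=\bigcup_{n\ge0}\mathcal H_n$. $t(H,f)=\int_{[0,1]^{V(H)}}\prod_{e\in E(H)}f(x_{e_s},x_{e_t})\prod_idx_i$, with $t(H,f)\equiv1$ if $H$ has no edges. The series is absolutely convergent at $f$ if $\sum_{n\ge0}\sum_{H\in\mathcal H_n}|a_H|\,t(H,|f|)<\infty$. *)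

theory Defs
  imports "HOL-Analysis.Analysis" "HOL-Library.Multiset"
begin

section \<open>Kernels and the overlay functional\<close>

abbreviation unit_interval :: "real set" where
  "unit_interval \<equiv> {0..1}"

text \<open>
  Functions on the unit square are represented by total functions; their values outside the
  square are never inspected. Measurability is Lebesgue measurability on the square.
\<close>

definition kernels :: "(real \<Rightarrow> real \<Rightarrow> real) set" where
  "kernels = {f.
     (\<exists>B. \<forall>x\<in>unit_interval. \<forall>y\<in>unit_interval. \<bar>f x y\<bar> \<le> B) \<and>
     (\<forall>x\<in>unit_interval. \<forall>y\<in>unit_interval. f x y = f y x) \<and>
     (\<lambda>(x, y). f x y) \<in> borel_measurable (lebesgue_on (unit_interval \<times> unit_interval))}"

definition graphons :: "(real \<Rightarrow> real \<Rightarrow> real) set" where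
  "graphons = {f \<in> kernels. \<forall>x\<in>unit_interval. \<forall>y\<in>unit_interval. f x y \<in> {0..1}}"

definition mp_automorphisms :: "(real \<Rightarrow> real) set" where
  "mp_automorphisms = {\<phi>.
     bij_betw \<phi> unit_interval unit_interval \<and>
     \<phi> \<in> lebesgue_on unit_interval \<rightarrow>\<^sub>M lebesgue_on unit_interval \<and>
     inv_into unit_interval \<phi> \<in> lebesgue_on unit_interval \<rightarrow>\<^sub>M lebesgue_on unit_interval \<and>
     distr (lebesgue_on unit_interval) (lebesgue_on unit_interval) \<phi> = lebesgue_on unit_interval}"

definition overlay :: "(real \<Rightarrow> real \<Rightarrow> real) \<Rightarrow> (real \<Rightarrow> real \<Rightarrow> real) \<Rightarrow> real" where
  "overlay U W = (SUP \<phi>\<in>mp_automorphisms.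
     integral\<^sup>L (lebesgue_on (unit_interval \<times> unit_interval))
       (\<lambda>(x, y). U x y * W (\<phi> x) (\<phi> y)))"


section \<open>Multigraphs up to isomorphism\<close>

text \<open>
  Edges form a multiset of two-element vertex sets, which allows parallel edges and excludes loops.
  Up to isomorphism every finite multigraph has its vertices among the natural numbers.
\<close>

record multigraph =
  verts :: "nat set"
  edges :: "nat set multiset"

definition is_multigraph :: "multigraph \<Rightarrow> bool" where
  "is_multigraph G \<longleftrightarrow> finite (verts G) \<and> (\<forall>e\<in>#edges G. e \<subseteq> verts G \<and> card e = 2)"

definition no_isolated_vertices :: "multigraph \<Rightarrow> bool" where
  "no_isolated_vertices G \<longleftrightarrow> (\<forall>v\<in>verts G. \<exists>e\<in>#edges G. v \<in> e)"

definition multigraph_iso :: "(multigraph \<times> multigraph) set" where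
  "multigraph_iso = {(G, G'). is_multigraph G \<and> is_multigraph G' \<and>
     (\<exists>h. bij_betw h (verts G) (verts G') \<and> image_mset ((`) h) (edges G) = edges G')}"

definition iso_classes :: "nat \<Rightarrow> multigraph set set" where
  "iso_classes n =
     {G. is_multigraph G \<and> no_isolated_vertices G \<and> size (edges G) = n} // multigraph_iso"

lemma equiv_multigraph_iso: "equiv {G. is_multigraph G} multigraph_iso"
proof (rule equivI)
  show "multigraph_iso \<subseteq> {G. is_multigraph G} \<times> {G. is_multigraph G}"
    by (auto simp: multigraph_iso_def)
  show "refl_on {G. is_multigraph G} multigraph_iso"
    by (auto simp: refl_on_def multigraph_iso_def intro!: exI[of _ id])
  show "sym multigraph_iso"
  proof (rule symI)
    fix G G' assume "(G, G') \<in> multigraph_iso"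
    then obtain h where G: "is_multigraph G" "is_multigraph G'"
      and h: "bij_betw h (verts G) (verts G')" "image_mset ((`) h) (edges G) = edges G'"
      by (auto simp: multigraph_iso_def)
    let ?k = "inv_into (verts G) h"
    have "image_mset ((`) ?k) (edges G') = image_mset (\<lambda>e. ?k ` h ` e) (edges G)"
      by (simp add: h(2)[symmetric] multiset.map_comp comp_def)
    also have "\<dots> = image_mset (\<lambda>e. e) (edges G)"
    proof (rule image_mset_cong)
      fix e assume "e \<in># edges G"
      then have "e \<subseteq> verts G" using G by (auto simp: is_multigraph_def)
      then show "?k ` h ` e = e"
        by (rule inv_into_image_cancel[OF bij_betw_imp_inj_on[OF h(1)]])
    qed
    finally show "(G', G) \<in> multigraph_iso"
      using G bij_betw_inv_into[OF h(1)] by (auto simp: multigraph_iso_def)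
  qed
  show "trans multigraph_iso"
  proof (rule transI)
    fix G G' G'' assume "(G, G') \<in> multigraph_iso" "(G', G'') \<in> multigraph_iso"
    then obtain h k where "is_multigraph G" "is_multigraph G''"
      and hk: "bij_betw h (verts G) (verts G')" "image_mset ((`) h) (edges G) = edges G'"
      "bij_betw k (verts G') (verts G'')" "image_mset ((`) k) (edges G') = edges G''"
      by (auto simp: multigraph_iso_def)
    moreover have "bij_betw (k \<circ> h) (verts G) (verts G'')"
      using hk by (blast intro: bij_betw_trans)
    moreover have "image_mset ((`) (k \<circ> h)) (edges G) = edges G''"
      by (simp add: hk(2,4)[symmetric] multiset.map_comp comp_def image_image)
    ultimately show "(G, G'') \<in> multigraph_iso"
      by (auto simp: multigraph_iso_def intro!: exI[of _ "k \<circ> h"])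
  qed
qed

text \<open>Finite sums over \<open>iso_classes n\<close> are genuine:\<close>

lemma finite_iso_classes: "finite (iso_classes n)"
proof -
  let ?N = "{..<2 * n}"
  let ?E = "{M. set_mset M \<subseteq> Pow ?N \<and> size M = n}"
  let ?B = "(\<lambda>(V, E). \<lparr>verts = V, edges = E\<rparr>) ` (Pow ?N \<times> ?E)"
  have "finite ?E"
    using finite_multisets_of_size[of "Pow ?N" n] by (simp add: multisets_of_size_def)
  then have finB: "finite ?B" by simp
  have "iso_classes n \<subseteq> (\<lambda>G. multigraph_iso `` {G}) ` ?B"
  proof
    fix c assume "c \<in> iso_classes n"
    then obtain G where G: "is_multigraph G" "no_isolated_vertices G" "size (edges G) = n"
      and c: "c = multigraph_iso `` {G}"
      by (auto simp: iso_classes_def quotient_def)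
    have "card (\<Union>(set_mset M)) \<le> 2 * size M" if "\<forall>e\<in>#M. card e = 2" for M :: "nat set multiset"
      using that
    proof (induction M)
      case (add e M)
      have "card (\<Union>(set_mset (add_mset e M))) \<le> card e + card (\<Union>(set_mset M))"
        by (simp add: card_Un_le)
      with add show ?case by simp
    qed simp
    from this[of "edges G"] have "card (\<Union>(set_mset (edges G))) \<le> 2 * n"
      using G(1,3) by (simp add: is_multigraph_def)
    moreover have "verts G = \<Union>(set_mset (edges G))"
      using G(1,2) by (auto simp: is_multigraph_def no_isolated_vertices_def)
    ultimately have card: "card (verts G) \<le> 2 * n"
      by simp
    have fin: "finite (verts G)" using G by (simp add: is_multigraph_def)
    obtain h where h: "bij_betw h (verts G) {0..<card (verts G)}"
      using ex_bij_betw_finite_nat[OF fin] by blast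
    define G' where "G' = \<lparr>verts = {0..<card (verts G)}, edges = image_mset ((`) h) (edges G)\<rparr>"
    have sub: "e \<subseteq> verts G" "card e = 2" if "e \<in># edges G" for e
      using G(1) that by (auto simp: is_multigraph_def)
    have img: "h ` e \<subseteq> {0..<card (verts G)}" "card (h ` e) = 2" if "e \<in># edges G" for e
    proof -
      show "h ` e \<subseteq> {0..<card (verts G)}"
        using sub(1)[OF that] h by (auto simp: bij_betw_def)
      show "card (h ` e) = 2"
        using sub[OF that] h by (metis bij_betw_imp_inj_on card_image inj_on_subset)
    qed
    have "is_multigraph G'"
      using img by (auto simp: is_multigraph_def G'_def)
    then have "(G, G') \<in> multigraph_iso"
      using G(1) h by (auto simp: multigraph_iso_def G'_def)
    then have "c = multigraph_iso `` {G'}"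
      unfolding c by (rule equiv_class_eq[OF equiv_multigraph_iso])
    moreover have "G' \<in> ?B"
    proof -
      have "({0..<card (verts G)}, image_mset ((`) h) (edges G)) \<in> Pow ?N \<times> ?E"
      proof (intro SigmaI)
        show "{0..<card (verts G)} \<in> Pow ?N" using card by auto
        show "image_mset ((`) h) (edges G) \<in> ?E"
          using img(1) card G(3) by fastforce
      qed
      from imageI[OF this, of "\<lambda>(V, E). \<lparr>verts = V, edges = E\<rparr>"]
      show ?thesis by (simp only: G'_def prod.case)
    qed
    ultimately show "c \<in> (\<lambda>G. multigraph_iso `` {G}) ` ?B" by blast
  qed
  then show ?thesis using finB by (meson finite_imageI finite_subset)
qed


section \<open>Homomorphism densities and series\<close>

text \<open>
  The order on the vertices serves to name the two endpoints of an edge; as kernels are symmetric,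
  the orientation is immaterial. The product measure has to be completed, because a Lebesgue
  measurable function of two coordinates need not be measurable for the product of the
  one-dimensional Lebesgue \<open>\<sigma>\<close>-algebras. For a graph without edges the integrand is \<open>1\<close>
  and the measure is a probability measure, so the density is \<open>1\<close>.
\<close>

definition hom_density :: "multigraph \<Rightarrow> (real \<Rightarrow> real \<Rightarrow> real) \<Rightarrow> real" where
  "hom_density G f =
     integral\<^sup>L (completion (PiM (verts G) (\<lambda>_. lebesgue_on unit_interval)))
       (\<lambda>x. \<Prod>e\<in>#edges G. f (x (Min e)) (x (Max e)))"

text \<open>The density is invariant under isomorphism, so any representative will do.\<close>

definition class_density :: "multigraph set \<Rightarrow> (real \<Rightarrow> real \<Rightarrow> real) \<Rightarrow> real" where
  "class_density H f = hom_density (SOME G. G \<in> H) f"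

definition absolutely_convergent_at ::
    "(multigraph set \<Rightarrow> real) \<Rightarrow> (real \<Rightarrow> real \<Rightarrow> real) \<Rightarrow> bool" where
  "absolutely_convergent_at a f \<longleftrightarrow>
     summable (\<lambda>n. \<Sum>H\<in>iso_classes n. \<bar>a H\<bar> * class_density H (\<lambda>x y. \<bar>f x y\<bar>))"

definition density_series :: "(multigraph set \<Rightarrow> real) \<Rightarrow> (real \<Rightarrow> real \<Rightarrow> real) \<Rightarrow> real" where
  "density_series a f = (\<Sum>n. \<Sum>H\<in>iso_classes n. a H * class_density H f)"

end

theory Submission
  imports Defs "HOL-Probability.Probability"
begin

text \<open>
  Let \<open>W\<close> be the indicator of the square of \<open>A = {0..<1/2}\<close>, and let \<open>f\<^sub>s = 1/2 + s W\<close>. Since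
  the integral of \<open>W\<close> is invariant under overlaying, \<open>C(f\<^sub>s, W) = 1/8 + C(s W, W)\<close>, which has a
  kink at \<open>s = 0\<close>: the identity gives \<open>C(f\<^sub>s, W) \<ge> 1/8 + s/4\<close> and the reflection
  \<open>x \<mapsto> 1 - x\<close> gives \<open>C(f\<^sub>-\<^sub>s, W) \<ge> 1/8\<close>. On the other hand, absolute convergence at the
  constant \<open>1\<close> means that \<open>\<Sum>\<bar>a\<^sub>H\<bar> < \<infinity>\<close>, and the second difference
  \<open>t(H, f\<^sub>s) + t(H, f\<^sub>-\<^sub>s) - 2 t(H, f\<^sub>0)\<close> is \<open>O(s\<^sup>2)\<close> uniformly in \<open>H\<close>. So the second difference
  of the series is \<open>O(s\<^sup>2)\<close>, while that of \<open>C(-, W)\<close> is at least \<open>s/4\<close>.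
\<close>

section \<open>Second differences of densities\<close>

lemma abs_prod_mset_le_1:
  fixes f :: "'a \<Rightarrow> real"
  assumes "\<And>e. e \<in># M \<Longrightarrow> \<bar>f e\<bar> \<le> 1"
  shows "\<bar>\<Prod>e\<in>#M. f e\<bar> \<le> 1"
  using assms by (induction M) (auto simp: abs_mult intro!: mult_le_one)

lemma half_perturbation_le_1:
  fixes r w :: real
  assumes "\<bar>r\<bar> \<le> 1/2" "\<bar>w\<bar> \<le> 1"
  shows "\<bar>1/2 + r * w\<bar> \<le> 1"
proof -
  have "\<bar>r * w\<bar> \<le> 1/2 * 1"
    unfolding abs_mult using assms by (intro mult_mono) auto
  then show ?thesis by linarith
qed

text \<open>The first difference is bounded alongside, since the recursion for the second one uses it.\<close>

lemma prod_mset_differences: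
  fixes g :: "'a \<Rightarrow> real"
  assumes g: "\<And>e. e \<in># M \<Longrightarrow> \<bar>g e\<bar> \<le> 1" and s: "0 \<le> s" "s \<le> 1/2"
  defines "P \<equiv> \<lambda>M r. \<Prod>e\<in>#M. 1/2 + r * g e"
  shows "\<bar>P M s - P M (-s)\<bar> \<le> 4 * s"
    and "\<bar>P M s + P M (-s) - 2 * P M 0\<bar> \<le> 8 * s\<^sup>2"
proof -
  have "\<bar>P M s - P M (-s)\<bar> \<le> 4 * s \<and> \<bar>P M s + P M (-s) - 2 * P M 0\<bar> \<le> 8 * s\<^sup>2"
    using g
  proof (induction M)
    case empty
    then show ?case using s by (simp add: P_def)
  next
    case (add e M)
    then have IH: "\<bar>P M s - P M (-s)\<bar> \<le> 4 * s" "\<bar>P M s + P M (-s) - 2 * P M 0\<bar> \<le> 8 * s\<^sup>2"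
      and ge: "\<bar>g e\<bar> \<le> 1" by auto
    have bd: "\<bar>P M s\<bar> \<le> 1" "\<bar>P M (-s)\<bar> \<le> 1"
      unfolding P_def using s add.prems
      by (intro abs_prod_mset_le_1 half_perturbation_le_1; simp)+
    \<comment> \<open>Each new edge multiplies by \<open>1/2 + r * g e\<close>: the constant term
      halves the old difference and the perturbation adds at most \<open>y\<close>. The bounds are
      the fixed points of \<open>x = x / 2 + y\<close>, namely \<open>4 * s\<close> for
      \<open>y = 2 * s\<close> and then \<open>8 * s\<^sup>2\<close> for
      \<open>y = 4 * s\<^sup>2\<close>. Hence they do not grow with the number of edges.\<close>
    have step: "\<bar>d\<bar> \<le> x / 2 + y" if "d = 1/2 * p + q" "\<bar>p\<bar> \<le> x" "\<bar>q\<bar> \<le> y" for d p q x y :: real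
      using that by (simp add: abs_le_iff)
    have rec: "P (add_mset e M) r = (1/2 + r * g e) * P M r" for r
      by (simp add: P_def)
    have 1: "P (add_mset e M) s - P (add_mset e M) (-s)
        = 1/2 * (P M s - P M (-s)) + s * (g e * (P M s + P M (-s)))"
      unfolding rec by (simp add: algebra_simps)
    have "\<bar>g e * (P M s + P M (-s))\<bar> \<le> 1 * 2"
      unfolding abs_mult using bd ge by (intro mult_mono) auto
    then have "\<bar>s * (g e * (P M s + P M (-s)))\<bar> \<le> s * 2"
      using s by (simp add: abs_mult mult_left_mono)
    from step[OF 1 IH(1) this]
    have A: "\<bar>P (add_mset e M) s - P (add_mset e M) (-s)\<bar> \<le> 4 * s"
      by simp
    have 2: "P (add_mset e M) s + P (add_mset e M) (-s) - 2 * P (add_mset e M) 0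
        = 1/2 * (P M s + P M (-s) - 2 * P M 0) + s * (g e * (P M s - P M (-s)))"
      unfolding rec by (simp add: algebra_simps)
    have "\<bar>g e * (P M s - P M (-s))\<bar> \<le> 1 * (4 * s)"
      unfolding abs_mult using IH(1) ge by (intro mult_mono) auto
    then have "\<bar>s * (g e * (P M s - P M (-s)))\<bar> \<le> s * (4 * s)"
      using s by (simp add: abs_mult mult_left_mono)
    from step[OF 2 IH(2) this]
    have "\<bar>P (add_mset e M) s + P (add_mset e M) (-s) - 2 * P (add_mset e M) 0\<bar> \<le> 8 * s\<^sup>2"
      by (simp add: power2_eq_square)
    with A show ?case by blast
  qed
  then show "\<bar>P M s - P M (-s)\<bar> \<le> 4 * s"
    and "\<bar>P M s + P M (-s) - 2 * P M 0\<bar> \<le> 8 * s\<^sup>2" by auto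
qed

section \<open>Densities as expectations over random vertex labellings\<close>

abbreviation labelling_space :: "multigraph \<Rightarrow> (nat \<Rightarrow> real) measure" where
  "labelling_space G \<equiv> completion (PiM (verts G) (\<lambda>_. lebesgue_on unit_interval))"

lemma prob_space_labelling: "prob_space (labelling_space G)"
proof -
  have "prob_space (lebesgue_on unit_interval)"
    by (rule prob_spaceI) (simp add: emeasure_restrict_space)
  then have "prob_space (PiM (verts G) (\<lambda>_. lebesgue_on unit_interval))"
    by (rule prob_space_PiM)
  then show ?thesis by (rule prob_space.prob_space_completion)
qed

lemma integral_labelling_const: "(\<integral>x. c \<partial>labelling_space G) = (c :: real)"
  using prob_space.prob_space[OF prob_space_labelling] by (simp del: measure_completion)

lemma multigraph_edge_ends:
  assumes "is_multigraph G" "e \<in># edges G"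
  shows "Min e \<in> verts G" "Max e \<in> verts G"
proof -
  have e: "e \<subseteq> verts G" "card e = 2" using assms by (auto simp: is_multigraph_def)
  then have "finite e" "e \<noteq> {}" by (auto intro!: card_ge_0_finite)
  then have "Min e \<in> e" "Max e \<in> e" by simp_all
  with e(1) show "Min e \<in> verts G" "Max e \<in> verts G" by auto
qed

lemma labelling_in_unit_interval:
  assumes "x \<in> space (labelling_space G)" "v \<in> verts G"
  shows "x v \<in> unit_interval"
  using assms by (auto simp: space_PiM PiE_def Pi_def)

text \<open>Borel measurability on the plane, stronger than what \<open>kernels\<close> demands,
  lets \<open>f\<close> be composed with any pair of coordinates. The integrand is then measurable
  even before completion. All kernels plugged in later are affine in \<open>block\<close> and hence
  Borel.\<close>

lemma measurable_hom_integrand: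
  fixes f :: "real \<Rightarrow> real \<Rightarrow> real"
  assumes G: "is_multigraph G" and f[measurable]: "(\<lambda>(x, y). f x y) \<in> borel_measurable borel"
  shows "(\<lambda>x. \<Prod>e\<in>#edges G. f (x (Min e)) (x (Max e))) \<in> borel_measurable (labelling_space G)"
proof (rule measurable_completion)
  let ?P = "PiM (verts G) (\<lambda>_. lebesgue_on unit_interval)"
  have coord: "(\<lambda>x. x v) \<in> borel_measurable ?P" if "v \<in> verts G" for v
  proof -
    have "(\<lambda>x. id (x v)) \<in> borel_measurable ?P"
      by (rule measurable_compose[OF measurable_component_singleton[OF that]])
        (rule id_borel_measurable_lebesgue_on)
    then show ?thesis by simp
  qed
  \<comment> \<open>Induction over submultisets of \<open>edges G\<close> keeps each added edge an
    edge of \<open>G\<close>, so that its endpoints are coordinates of the product space.\<close>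
  have "(\<lambda>x. \<Prod>e\<in>#M. f (x (Min e)) (x (Max e))) \<in> borel_measurable ?P" if "M \<subseteq># edges G" for M
    using that
  proof (induction M)
    case (add e M)
    then have e: "e \<in># edges G" and M: "M \<subseteq># edges G"
      by (auto dest: mset_subset_eqD mset_subset_eq_insertD intro: subset_mset.less_imp_le)
    have "(\<lambda>x. (x (Min e), x (Max e))) \<in> borel_measurable ?P"
      using coord multigraph_edge_ends[OF G e] by (intro borel_measurable_Pair)
    from measurable_compose[OF this f] show ?case
      using add.IH[OF M] by simp
  qed simp
  then show "(\<lambda>x. \<Prod>e\<in>#edges G. f (x (Min e)) (x (Max e))) \<in> borel_measurable ?P"
    by simp
qed

lemma hom_integrand_le_1:
  fixes f :: "real \<Rightarrow> real \<Rightarrow> real"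
  assumes "is_multigraph G" "\<And>x y. x \<in> unit_interval \<Longrightarrow> y \<in> unit_interval \<Longrightarrow> \<bar>f x y\<bar> \<le> 1"
    and "x \<in> space (labelling_space G)"
  shows "\<bar>\<Prod>e\<in>#edges G. f (x (Min e)) (x (Max e))\<bar> \<le> 1"
proof (rule abs_prod_mset_le_1)
  fix e assume "e \<in># edges G"
  from multigraph_edge_ends[OF assms(1) this]
  show "\<bar>f (x (Min e)) (x (Max e))\<bar> \<le> 1"
    by (intro assms(2) labelling_in_unit_interval[OF assms(3)])
qed

lemma integrable_hom_integrand:
  fixes f :: "real \<Rightarrow> real \<Rightarrow> real"
  assumes "is_multigraph G" "(\<lambda>(x, y). f x y) \<in> borel_measurable borel"
    and "\<And>x y. x \<in> unit_interval \<Longrightarrow> y \<in> unit_interval \<Longrightarrow> \<bar>f x y\<bar> \<le> 1"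
  shows "integrable (labelling_space G) (\<lambda>x. \<Prod>e\<in>#edges G. f (x (Min e)) (x (Max e)))"
proof -
  interpret prob_space "labelling_space G" by (rule prob_space_labelling)
  show ?thesis
  proof (rule integrable_const_bound[where B = 1])
    show "AE x in labelling_space G. norm (\<Prod>e\<in>#edges G. f (x (Min e)) (x (Max e))) \<le> 1"
      unfolding real_norm_def by (intro AE_I2 hom_integrand_le_1[OF assms(1,3)])
  qed (rule measurable_hom_integrand[OF assms(1,2)])
qed

lemma abs_hom_density_le_1:
  fixes f :: "real \<Rightarrow> real \<Rightarrow> real"
  assumes "is_multigraph G" "(\<lambda>(x, y). f x y) \<in> borel_measurable borel"
    and "\<And>x y. x \<in> unit_interval \<Longrightarrow> y \<in> unit_interval \<Longrightarrow> \<bar>f x y\<bar> \<le> 1"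
  shows "\<bar>hom_density G f\<bar> \<le> 1"
proof -
  interpret prob_space "labelling_space G" by (rule prob_space_labelling)
  have "\<bar>hom_density G f\<bar>
      \<le> (\<integral>x. \<bar>\<Prod>e\<in>#edges G. f (x (Min e)) (x (Max e))\<bar> \<partial>labelling_space G)"
    unfolding hom_density_def by (rule integral_abs_bound)
  also have "\<dots> \<le> (\<integral>x. 1 \<partial>labelling_space G)"
    by (intro integral_mono integrable_abs integrable_hom_integrand[OF assms]
        hom_integrand_le_1[OF assms(1,3)] integrable_const)
  finally show ?thesis by (simp only: integral_labelling_const)
qed

lemma hom_density_one: "hom_density G (\<lambda>x y. 1) = 1"
  using integral_labelling_const[of G 1] by (simp add: hom_density_def)

lemma measurable_affine_kernel:
  fixes g :: "real \<Rightarrow> real \<Rightarrow> real"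
  assumes "(\<lambda>(x, y). g x y) \<in> borel_measurable borel"
  shows "(\<lambda>(x, y). c + r * g x y) \<in> borel_measurable borel"
proof -
  have "(\<lambda>p. c + r * (\<lambda>(x, y). g x y) p) \<in> borel_measurable borel"
    using assms by measurable
  then show ?thesis by (simp add: split_beta')
qed

text \<open>The second difference may be taken inside the integral, where the bound for edge
  products holds pointwise. Integrating over a probability space preserves that bound, so it depends
  neither on the vertices nor on the edges of \<open>G\<close>.\<close>

lemma hom_density_second_difference:
  fixes g :: "real \<Rightarrow> real \<Rightarrow> real"
  assumes G: "is_multigraph G" and g: "(\<lambda>(x, y). g x y) \<in> borel_measurable borel"
    and bd: "\<And>x y. x \<in> unit_interval \<Longrightarrow> y \<in> unit_interval \<Longrightarrow> \<bar>g x y\<bar> \<le> 1"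
    and s: "0 \<le> s" "s \<le> 1/2"
  defines "F \<equiv> \<lambda>r. hom_density G (\<lambda>x y. 1/2 + r * g x y)"
  shows "\<bar>F s + F (-s) - 2 * F 0\<bar> \<le> 8 * s\<^sup>2"
proof -
  interpret prob_space "labelling_space G" by (rule prob_space_labelling)
  define p where "p = (\<lambda>r x. \<Prod>e\<in>#edges G. 1/2 + r * g (x (Min e)) (x (Max e)))"
  have F: "F r = (\<integral>x. p r x \<partial>labelling_space G)" for r
    by (simp add: F_def hom_density_def p_def)
  have int: "integrable (labelling_space G) (p r)" if "\<bar>r\<bar> \<le> 1/2" for r
    unfolding p_def
    by (intro integrable_hom_integrand[where f = "\<lambda>x y. 1/2 + r * g x y"] G
        half_perturbation_le_1 measurable_affine_kernel g bd that)
  have I: "integrable (labelling_space G) (p s)" "integrable (labelling_space G) (p (-s))"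
      "integrable (labelling_space G) (p 0)"
    using s by (auto intro!: int)
  have pt: "\<bar>p s x + p (-s) x - 2 * p 0 x\<bar> \<le> 8 * s\<^sup>2" if "x \<in> space (labelling_space G)" for x
    unfolding p_def
    by (rule prod_mset_differences(2)[where g = "\<lambda>e. g (x (Min e)) (x (Max e))", OF _ s])
      (intro bd labelling_in_unit_interval[OF that] multigraph_edge_ends[OF G]; assumption)
  have "\<bar>F s + F (-s) - 2 * F 0\<bar> = \<bar>\<integral>x. p s x + p (-s) x - 2 * p 0 x \<partial>labelling_space G\<bar>"
    using I by (simp add: F)
  also have "\<dots> \<le> (\<integral>x. \<bar>p s x + p (-s) x - 2 * p 0 x\<bar> \<partial>labelling_space G)"
    by (rule integral_abs_bound)
  also have "\<dots> \<le> (\<integral>x. 8 * s\<^sup>2 \<partial>labelling_space G)"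
    using I pt by (intro integral_mono) auto
  finally show ?thesis by (simp only: integral_labelling_const)
qed

section \<open>From single densities to the whole series\<close>

text \<open>The representative picked by \<open>SOME\<close> is a genuine multigraph, because
  classes of an equivalence relation are nonempty and stay inside its carrier. This makes the bounds
  for \<open>hom_density\<close> available for classes.\<close>

lemma class_density_eq_hom_density:
  assumes "H \<in> iso_classes n"
  obtains G where "is_multigraph G" "\<And>f. class_density H f = hom_density G f"
proof
  have "H \<in> {G. is_multigraph G} // multigraph_iso"
    using assms unfolding iso_classes_def quotient_def by auto
  then have "H \<noteq> {}" "H \<subseteq> {G. is_multigraph G}"
    using equiv_multigraph_iso by (auto dest: in_quotient_imp_non_empty in_quotient_imp_subset)
  then show "is_multigraph (SOME G. G \<in> H)" by (metis mem_Collect_eq some_in_eq subsetD)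
qed (simp add: class_density_def)

text \<open>The uniform bound for one density is summed with weights \<open>\<bar>a H\<bar>\<close>.
  Every density equals 1 at the constant kernel 1, so \<open>conv\<close> says exactly that the sum
  of these weights converges.\<close>

lemma density_series_second_difference:
  fixes g :: "real \<Rightarrow> real \<Rightarrow> real"
  assumes conv: "absolutely_convergent_at a (\<lambda>x y. 1)"
    and g: "(\<lambda>(x, y). g x y) \<in> borel_measurable borel"
    and bd: "\<And>x y. x \<in> unit_interval \<Longrightarrow> y \<in> unit_interval \<Longrightarrow> \<bar>g x y\<bar> \<le> 1"
    and s: "0 \<le> s" "s \<le> 1/2"
  defines "F \<equiv> \<lambda>r. density_series a (\<lambda>x y. 1/2 + r * g x y)"
  shows "\<bar>F s + F (-s) - 2 * F 0\<bar> \<le> 8 * s\<^sup>2 * (\<Sum>n. \<Sum>H\<in>iso_classes n. \<bar>a H\<bar>)"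
proof -
  define T where "T = (\<lambda>r n. \<Sum>H\<in>iso_classes n. a H * class_density H (\<lambda>x y. 1/2 + r * g x y))"
  have F: "F r = suminf (T r)" for r by (simp add: F_def T_def density_series_def)
  have one: "class_density H (\<lambda>x y. 1) = 1" for H
    by (simp add: class_density_def hom_density_one)
  have A: "summable (\<lambda>n. \<Sum>H\<in>iso_classes n. \<bar>a H\<bar>)"
    using conv by (simp add: absolutely_convergent_at_def one)
  \<comment> \<open>For such \<open>r\<close> the perturbed kernel has values in [-1, 1] and so do
    its densities. The weights therefore dominate the series at \<open>s\<close>, \<open>-s\<close>
    and 0 alike, and the three can be combined termwise.\<close>
  have T: "summable (T r)" if "\<bar>r\<bar> \<le> 1/2" for r
  proof (rule summable_comparison_test'[OF A])
    fix n
    have "\<bar>class_density H (\<lambda>x y. 1/2 + r * g x y)\<bar> \<le> 1" if "H \<in> iso_classes n" for H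
    proof -
      obtain G where G: "is_multigraph G" "\<And>f. class_density H f = hom_density G f"
        by (rule class_density_eq_hom_density[OF \<open>H \<in> iso_classes n\<close>]) (rule that)
      show ?thesis unfolding G(2)
        by (intro abs_hom_density_le_1 G(1) half_perturbation_le_1 measurable_affine_kernel g bd
            \<open>\<bar>r\<bar> \<le> 1/2\<close>)
    qed
    then have "\<bar>a H * class_density H (\<lambda>x y. 1/2 + r * g x y)\<bar> \<le> \<bar>a H\<bar>"
      if "H \<in> iso_classes n" for H
      using that by (simp add: abs_mult mult_left_le)
    then show "norm (T r n) \<le> (\<Sum>H\<in>iso_classes n. \<bar>a H\<bar>)"
      unfolding T_def real_norm_def by (intro order_trans[OF sum_abs] sum_mono)
  qed
  have Ts: "summable (T s)" "summable (T (-s))" "summable (T 0)"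
    using s by (auto intro!: T)
  have diff: "\<bar>T s n + T (-s) n - 2 * T 0 n\<bar> \<le> 8 * s\<^sup>2 * (\<Sum>H\<in>iso_classes n. \<bar>a H\<bar>)" for n
  proof -
    let ?d = "\<lambda>H r. class_density H (\<lambda>x y. 1/2 + r * g x y)"
    have distrib: "x * p + x * q - 2 * (x * u) = x * (p + q - 2 * u)" for x p q u :: real
      by (simp add: algebra_simps)
    have eq: "T s n + T (-s) n - 2 * T 0 n
        = (\<Sum>H\<in>iso_classes n. a H * (?d H s + ?d H (-s) - 2 * ?d H 0))"
      unfolding T_def sum_distrib_left sum.distrib[symmetric] sum_subtractf[symmetric]
      by (rule sum.cong[OF refl distrib])
    have "\<bar>T s n + T (-s) n - 2 * T 0 n\<bar> \<le> (\<Sum>H\<in>iso_classes n. \<bar>a H\<bar> * (8 * s\<^sup>2))"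
      unfolding eq
    proof (intro order_trans[OF sum_abs] sum_mono)
      fix H assume H: "H \<in> iso_classes n"
      obtain G where G: "is_multigraph G" "\<And>f. class_density H f = hom_density G f"
        by (rule class_density_eq_hom_density[OF H]) (rule that)
      have "\<bar>?d H s + ?d H (-s) - 2 * ?d H 0\<bar> \<le> 8 * s\<^sup>2"
        unfolding G(2) by (rule hom_density_second_difference[OF G(1) g bd s])
      then show "\<bar>a H * (?d H s + ?d H (-s) - 2 * ?d H 0)\<bar> \<le> \<bar>a H\<bar> * (8 * s\<^sup>2)"
        by (subst abs_mult) (rule mult_left_mono[OF _ abs_ge_zero])
    qed
    also have "\<dots> = 8 * s\<^sup>2 * (\<Sum>H\<in>iso_classes n. \<bar>a H\<bar>)"
      by (subst sum_distrib_right[symmetric]) (rule mult.commute)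
    finally show ?thesis .
  qed
  have eq: "F s + F (-s) - 2 * F 0 = (\<Sum>n. T s n + T (-s) n - 2 * T 0 n)"
    unfolding F by (intro sums_unique sums_diff sums_add sums_mult summable_sums Ts)
  have "\<bar>F s + F (-s) - 2 * F 0\<bar> \<le> (\<Sum>n. 8 * s\<^sup>2 * (\<Sum>H\<in>iso_classes n. \<bar>a H\<bar>))"
  proof -
    have S: "summable (\<lambda>n. 8 * s\<^sup>2 * (\<Sum>H\<in>iso_classes n. \<bar>a H\<bar>))"
      using A by (rule summable_mult)
    have S': "summable (\<lambda>n. \<bar>T s n + T (-s) n - 2 * T 0 n\<bar>)"
      by (rule summable_comparison_test'[OF S]) (use diff in simp)
    show ?thesis
      unfolding eq using summable_rabs[OF S'] suminf_le[OF diff S' S] by (rule order_trans)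
  qed
  also have "\<dots> = 8 * s\<^sup>2 * (\<Sum>n. \<Sum>H\<in>iso_classes n. \<bar>a H\<bar>)"
    using A by (rule suminf_mult)
  finally show ?thesis .
qed

section \<open>Overlays of a block\<close>

text \<open>Each factor is a Borel set up to a subset of a Borel null set, and the product differs
  from that of the Borel parts only inside two null strips. Lebesgue factors matter because
  preimages under \<open>mp_automorphisms\<close> are only known to be Lebesgue sets.\<close>

lemma lebesgue_Times:
  fixes S :: "'a::euclidean_space set" and T :: "'b::euclidean_space set"
  assumes "S \<in> sets lebesgue" "T \<in> sets lebesgue"
  shows "S \<times> T \<in> sets lebesgue"
    and "emeasure lebesgue (S \<times> T) = emeasure lebesgue S * emeasure lebesgue T"
proof -
  obtain B N N' where S: "S = B \<union> N" "N \<subseteq> N'" "N' \<in> null_sets lborel" "B \<in> sets lborel"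
    using assms(1) by (auto elim: sets_completionE)
  obtain C K K' where T: "T = C \<union> K" "K \<subseteq> K'" "K' \<in> null_sets lborel" "C \<in> sets lborel"
    using assms(2) by (auto elim: sets_completionE)
  have em: "emeasure lborel (X \<times> Y) = emeasure lborel X * emeasure lborel Y"
    if "X \<in> sets borel" "Y \<in> sets borel" for X :: "'a set" and Y :: "'b set"
    using that unfolding lborel_prod[symmetric]
    by (intro lborel.emeasure_pair_measure_Times) auto
  let ?Z = "(N' \<times> UNIV) \<union> (UNIV \<times> K')"
  \<comment> \<open>Each strip has measure zero times infinity, which is 0 in
    \<open>ennreal\<close>.\<close>
  have Z: "?Z \<in> null_sets lborel"
    using S(3) T(3) by (intro null_sets.Un) (auto simp: null_sets_def em borel_Times)
  have BC: "B \<times> C \<in> sets lborel" using S(4) T(4) by (simp add: borel_Times)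
  have eq: "S \<times> T = (B \<times> C) \<union> (S \<times> T - B \<times> C)" using S(1) T(1) by auto
  have sub: "S \<times> T - B \<times> C \<subseteq> ?Z" using S T by auto
  show "S \<times> T \<in> sets lebesgue"
    by (rule sets_completionI[OF eq sub Z BC])
  have N: "S \<times> T - B \<times> C \<in> null_sets lebesgue"
    using sub Z by (auto simp: null_sets_completion_iff2)
  have "emeasure lebesgue (S \<times> T) = emeasure lebesgue (B \<times> C)"
    using emeasure_Un_null_set[OF sets_completionI_sets[OF BC] N] by (simp only: eq[symmetric])
  also have "\<dots> = emeasure lborel B * emeasure lborel C"
    using BC S(4) T(4) by (simp add: em)
  also have "emeasure lborel B = emeasure lebesgue S"
  proof -
    have "N \<in> null_sets lebesgue" using S by (auto simp: null_sets_completion_iff2)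
    then show ?thesis using S by (simp add: emeasure_Un_null_set)
  qed
  also have "emeasure lborel C = emeasure lebesgue T"
  proof -
    have "K \<in> null_sets lebesgue" using T by (auto simp: null_sets_completion_iff2)
    then show ?thesis using T by (simp add: emeasure_Un_null_set)
  qed
  finally show "emeasure lebesgue (S \<times> T) = emeasure lebesgue S * emeasure lebesgue T" .
qed

abbreviation unit_square_measure :: "(real \<times> real) measure" where
  "unit_square_measure \<equiv> lebesgue_on (unit_interval \<times> unit_interval)"

lemma unit_square_in_sets_lebesgue: "unit_interval \<times> unit_interval \<in> sets lebesgue"
  by (rule lebesgue_Times) auto

lemma prob_space_unit_square: "prob_space unit_square_measure"
proof (rule prob_spaceI)
  have "emeasure lebesgue (unit_interval \<times> unit_interval) = 1"
    by (subst lebesgue_Times(2)) auto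
  then show "emeasure unit_square_measure (space unit_square_measure) = 1"
    by (simp add: emeasure_restrict_space unit_square_in_sets_lebesgue del: emeasure_completion)
qed

lemma indicator_Times_unit_square:
  assumes "S \<in> sets lebesgue" "T \<in> sets lebesgue" "S \<subseteq> unit_interval" "T \<subseteq> unit_interval"
  shows "integrable unit_square_measure (indicat_real (S \<times> T))"
    and "(\<integral>p. indicator (S \<times> T) p \<partial>unit_square_measure) = measure lebesgue S * measure lebesgue T"
proof -
  interpret prob_space unit_square_measure by (rule prob_space_unit_square)
  have sub: "S \<times> T \<subseteq> unit_interval \<times> unit_interval" using assms by auto
  have ST: "S \<times> T \<in> sets unit_square_measure"
    using assms sub lebesgue_Times(1)[OF assms(1,2)]
    by (simp add: sets_restrict_space_iff unit_square_in_sets_lebesgue)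
  then show "integrable unit_square_measure (indicat_real (S \<times> T))"
    by (intro integrable_real_indicator) (auto simp: less_top[symmetric])
  have "(\<integral>p. indicator (S \<times> T) p \<partial>unit_square_measure) = measure unit_square_measure (S \<times> T)"
    using ST sets.sets_into_space[OF ST] by (simp add: Int_absorb1 Int_absorb2)
  also have "\<dots> = measure lebesgue (S \<times> T)"
    using sub by (simp add: measure_restrict_space unit_square_in_sets_lebesgue)
  also have "\<dots> = measure lebesgue S * measure lebesgue T"
    using assms by (simp add: measure_def lebesgue_Times(2) enn2real_mult)
  finally show "(\<integral>p. indicator (S \<times> T) p \<partial>unit_square_measure)
      = measure lebesgue S * measure lebesgue T" .
qed

section \<open>Measure-preserving maps of the interval\<close>

lemma id_mp_automorphism: "(\<lambda>x. x) \<in> mp_automorphisms"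
proof -
  \<comment> \<open>Off the interval the value of \<open>inv_into\<close> is unspecified, so it is
    first replaced by the map with which it agrees on the space.\<close>
  have "inv_into unit_interval (\<lambda>x. x) \<in> lebesgue_on unit_interval \<rightarrow>\<^sub>M lebesgue_on unit_interval"
    by (subst measurable_cong[where g = "\<lambda>x. x"])
      (auto intro!: inv_into_f_eq[of "\<lambda>x. x"] simp: inj_on_def)
  moreover have "bij_betw (\<lambda>x. x) unit_interval unit_interval" by (simp add: bij_betw_def)
  ultimately show ?thesis by (simp add: mp_automorphisms_def)
qed

text \<open>An affine map of slope -1 preserves Lebesgue measure on the line, and this one is an
  involution of the interval. It carries \<open>{0..<1/2}\<close> onto \<open>{1/2<..1}\<close>,
  which gives an overlay where the two blocks do not meet.\<close>

lemma reflection_mp_automorphism: "(\<lambda>x. 1 - x) \<in> mp_automorphisms"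
proof -
  let ?r = "\<lambda>x::real. 1 - x"
  have bij: "bij_betw ?r unit_interval unit_interval"
    by (rule bij_betwI[where g = ?r]) auto
  have meas0: "?r \<in> lebesgue \<rightarrow>\<^sub>M lebesgue"
    using lebesgue_affine_measurable[where c = "\<lambda>_::real. -1" and t = 1] by simp
  have distr0: "distr lebesgue lebesgue ?r = lebesgue"
    using lebesgue_real_affine[of "-1" 1] by (simp add: density_1)
  have meas: "?r \<in> lebesgue_on unit_interval \<rightarrow>\<^sub>M lebesgue_on unit_interval"
    by (intro measurable_restrict_space2 measurable_restrict_space1 meas0) auto
  have inv: "inv_into unit_interval ?r x = ?r x" if "x \<in> unit_interval" for x
    using that by (intro inv_into_f_eq) (auto simp: inj_on_def)
  have "inv_into unit_interval ?r \<in> lebesgue_on unit_interval \<rightarrow>\<^sub>M lebesgue_on unit_interval"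
    using meas by (subst measurable_cong[where g = ?r]) (auto intro!: inv)
  moreover have "distr (lebesgue_on unit_interval) (lebesgue_on unit_interval) ?r
      = lebesgue_on unit_interval"
  proof (rule measure_eqI)
    fix S assume "S \<in> sets (distr (lebesgue_on unit_interval) (lebesgue_on unit_interval) ?r)"
    then have S: "S \<in> sets (lebesgue_on unit_interval)" by simp
    then have S': "S \<subseteq> unit_interval" "S \<in> sets lebesgue"
      by (auto simp: sets_restrict_space_iff)
    have pre: "?r -` S \<subseteq> unit_interval" using S'(1) by auto
    have "emeasure (distr (lebesgue_on unit_interval) (lebesgue_on unit_interval) ?r) S
        = emeasure (lebesgue_on unit_interval) (?r -` S)"
      using meas S pre by (simp add: emeasure_distr Int_absorb2)
    also have "\<dots> = emeasure lebesgue (?r -` S)"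
      using pre by (simp add: emeasure_restrict_space)
    also have "\<dots> = emeasure (distr lebesgue lebesgue ?r) S"
      using meas0 S' by (simp add: emeasure_distr)
    also have "\<dots> = emeasure (lebesgue_on unit_interval) S"
      unfolding distr0 using S' by (simp add: emeasure_restrict_space)
    finally show "emeasure (distr (lebesgue_on unit_interval) (lebesgue_on unit_interval) ?r) S
        = emeasure (lebesgue_on unit_interval) S" .
  qed simp
  ultimately show ?thesis using bij meas by (simp add: mp_automorphisms_def)
qed

lemma mp_automorphism_vimage:
  assumes \<phi>: "\<phi> \<in> mp_automorphisms" and S: "S \<in> sets lebesgue" "S \<subseteq> unit_interval"
  shows "\<phi> -` S \<inter> unit_interval \<in> sets lebesgue"
    and "measure lebesgue (\<phi> -` S \<inter> unit_interval) = measure lebesgue S"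
proof -
  let ?M = "lebesgue_on unit_interval"
  have m: "\<phi> \<in> ?M \<rightarrow>\<^sub>M ?M" and d: "distr ?M ?M \<phi> = ?M"
    using \<phi> by (auto simp: mp_automorphisms_def)
  have SM: "S \<in> sets ?M" using S by (simp add: sets_restrict_space_iff)
  from measurable_sets[OF m SM] show "\<phi> -` S \<inter> unit_interval \<in> sets lebesgue"
    by (auto simp: sets_restrict_space_iff)
  have "measure ?M (\<phi> -` S \<inter> unit_interval) = measure (distr ?M ?M \<phi>) S"
    using m SM by (simp add: measure_distr)
  then have "measure ?M (\<phi> -` S \<inter> unit_interval) = measure ?M S" by (simp only: d)
  then show "measure lebesgue (\<phi> -` S \<inter> unit_interval) = measure lebesgue S"
    using S by (simp add: measure_restrict_space)
qed

section \<open>The block kernel and its overlays\<close>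

text \<open>Length 1/2 is short enough for the interval to be moved off itself, and half-openness
  makes it exactly disjoint from its mirror image, without a shared midpoint.\<close>

definition block :: "real \<Rightarrow> real \<Rightarrow> real" where
  "block x y = indicator {0..<1/2} x * indicator {0..<1/2} y"

lemma measurable_block: "(\<lambda>(x, y). block x y) \<in> borel_measurable borel"
  unfolding block_def borel_prod[symmetric] by measurable

lemma block_bounds: "0 \<le> block x y" "block x y \<le> 1"
  by (auto simp: block_def indicator_def)

text \<open>Stated for general \<open>c\<close> and \<open>r\<close> to cover \<open>block\<close>
  itself, the constant 1 and the perturbations of 1/2 at once.\<close>

lemma perturbed_block_graphon:
  assumes "\<And>w. 0 \<le> w \<Longrightarrow> w \<le> 1 \<Longrightarrow> 0 \<le> c + r * w \<and> c + r * w \<le> 1"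
  shows "(\<lambda>x y. c + r * block x y) \<in> graphons"
proof -
  have "(\<lambda>(x, y). c + r * block x y) \<in> borel_measurable unit_square_measure"
    using measurable_affine_kernel[OF measurable_block]
    by (intro measurable_restrict_space1 measurable_completion) simp
  moreover have "c + r * block x y = c + r * block y x" for x y
    by (simp add: block_def)
  moreover have "0 \<le> c + r * block x y" "c + r * block x y \<le> 1" for x y
    using assms block_bounds by auto
  ultimately show ?thesis
    unfolding graphons_def kernels_def by (auto intro!: exI[of _ 1] simp: abs_le_iff) (smt (verit))
qed

lemma block_graphon: "block \<in> graphons"
  using perturbed_block_graphon[of 0 1] by simp

lemma half_perturbed_block_graphon:
  assumes "\<bar>r\<bar> \<le> 1/2"
  shows "(\<lambda>x y. 1/2 + r * block x y) \<in> graphons"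
proof (rule perturbed_block_graphon)
  fix w :: real assume w: "0 \<le> w" "w \<le> 1"
  have "\<bar>r * w\<bar> \<le> 1/2 * 1"
    unfolding abs_mult using assms w by (intro mult_mono) auto
  then show "0 \<le> 1/2 + r * w \<and> 1/2 + r * w \<le> 1" by linarith
qed

definition overlay_integral :: "(real \<Rightarrow> real \<Rightarrow> real) \<Rightarrow> (real \<Rightarrow> real) \<Rightarrow> real" where
  "overlay_integral U \<phi> = (\<integral>(x, y). U x y * block (\<phi> x) (\<phi> y) \<partial>unit_square_measure)"

lemma overlay_block: "overlay U block = (SUP \<phi>\<in>mp_automorphisms. overlay_integral U \<phi>)"
  by (simp add: overlay_def overlay_integral_def)

text \<open>Multiplying out gives indicators of two squares. The preimage of the half interval has
  measure 1/2 for every \<phi>, so the constant part always contributes 1/2 times 1/4. Only the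
  overlap of the half interval with its preimage depends on \<phi>.\<close>

lemma overlay_integral_perturbed_block:
  assumes "\<phi> \<in> mp_automorphisms"
  shows "overlay_integral (\<lambda>x y. 1/2 + r * block x y) \<phi>
    = 1/8 + r * (measure lebesgue ({0..<1/2} \<inter> \<phi> -` {0..<1/2}))\<^sup>2"
proof -
  let ?A = "{0..<1/2::real}"
  let ?S = "\<phi> -` ?A \<inter> unit_interval" and ?T = "?A \<inter> \<phi> -` ?A"
  have "?A \<in> sets lebesgue" "?A \<subseteq> unit_interval" by auto
  then have S: "?S \<in> sets lebesgue" "measure lebesgue ?S = 1/2"
    using mp_automorphism_vimage[OF assms, of ?A] by simp_all
  \<comment> \<open>Nothing is known about \<phi> outside the unit interval. Since \<open>?A\<close>
    lies inside it, the overlap can be expressed through the measurable set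
    \<open>?S\<close>.\<close>
  have TS: "?T = ?A \<inter> ?S" by auto
  have T: "?T \<in> sets lebesgue" unfolding TS using S(1) by auto
  have sub: "?S \<subseteq> unit_interval" "?T \<subseteq> unit_interval" by auto
  have ind: "indicat_real ?S x = indicator ?A (\<phi> x)"
    "indicat_real ?T x = indicator ?A x * indicator ?A (\<phi> x)" if "x \<in> unit_interval" for x
    using that by (simp_all only: indicator_inter_arith indicator_vimage comp_def indicator_simps mult_1_right)
  have "(1/2 + r * block x y) * block (\<phi> x) (\<phi> y)
      = 1/2 * indicator (?S \<times> ?S) (x, y) + r * indicator (?T \<times> ?T) (x, y)"
    if "x \<in> unit_interval" "y \<in> unit_interval" for x y
    unfolding block_def indicator_times fst_conv snd_conv ind[OF that(1)] ind[OF that(2)]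
    by (simp only: ring_distribs mult_ac)
  then have "overlay_integral (\<lambda>x y. 1/2 + r * block x y) \<phi>
      = (\<integral>p. 1/2 * indicator (?S \<times> ?S) p + r * indicator (?T \<times> ?T) p \<partial>unit_square_measure)"
    unfolding overlay_integral_def split_beta
    by (intro Bochner_Integration.integral_cong refl)
      (metis mem_Times_iff prod.collapse space_lebesgue_on)
  also have "\<dots> = 1/2 * (measure lebesgue ?S * measure lebesgue ?S)
      + r * (measure lebesgue ?T * measure lebesgue ?T)"
    by (simp only: Bochner_Integration.integral_add integrable_mult_right integral_mult_right_zero
        indicator_Times_unit_square[OF S(1) S(1) sub(1) sub(1)]
        indicator_Times_unit_square[OF T T sub(2) sub(2)])
  also have "\<dots> = 1/8 + r * (measure lebesgue ?T)\<^sup>2"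
    unfolding S(2) by (simp add: power2_eq_square)
  finally show ?thesis .
qed

text \<open>A real supremum dominates its members once the family is bounded above. The overlap has
  measure at most 1/2, so even the crude estimate 1/8 + 1/2 stays below 1.\<close>

lemma overlay_integral_le_overlay:
  assumes "\<bar>r\<bar> \<le> 1/2" "\<phi> \<in> mp_automorphisms"
  shows "overlay_integral (\<lambda>x y. 1/2 + r * block x y) \<phi> \<le> overlay (\<lambda>x y. 1/2 + r * block x y) block"
  unfolding overlay_block
proof (rule cSUP_upper[OF assms(2)], rule bdd_aboveI2)
  fix \<psi> assume \<psi>: "\<psi> \<in> mp_automorphisms"
  let ?m = "measure lebesgue ({0..<1/2} \<inter> \<psi> -` {0..<1/2})"
  have eq: "{0..<1/2} \<inter> \<psi> -` {0..<1/2} = {0..<1/2} \<inter> (\<psi> -` {0..<1/2} \<inter> unit_interval)"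
    by auto
  have "{0..<1/2} \<inter> \<psi> -` {0..<1/2} \<in> sets lebesgue"
    unfolding eq by (rule sets.Int[OF _ mp_automorphism_vimage(1)[OF \<psi>]]) auto
  then have "?m \<le> measure lebesgue {0..<1/2::real}"
    by (intro measure_mono_fmeasurable bounded_set_imp_lmeasurable) auto
  then have "?m\<^sup>2 \<le> 1\<^sup>2" by (intro power_mono) auto
  then have "r * ?m\<^sup>2 \<le> 1/2 * 1"
    using assms(1) by (intro mult_mono) auto
  then show "overlay_integral (\<lambda>x y. 1/2 + r * block x y) \<psi> \<le> 1"
    unfolding overlay_integral_perturbed_block[OF \<psi>] by simp
qed

lemma overlay_block_second_difference:
  assumes "0 \<le> s" "s \<le> 1/2"
  defines "F \<equiv> \<lambda>r. overlay (\<lambda>x y. 1/2 + r * block x y) block"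
  shows "s / 4 \<le> F s + F (-s) - 2 * F 0"
proof -
  have "1/8 + s / 4 \<le> F s"
    using overlay_integral_le_overlay[OF _ id_mp_automorphism, of s] assms
      overlay_integral_perturbed_block[OF id_mp_automorphism, of s]
    by (simp add: power2_eq_square vimage_def)
  moreover have "1/8 \<le> F (-s)"
  proof -
    have "{0..<1/2} \<inter> (\<lambda>x. 1 - x) -` {0..<1/2::real} = {}" by auto
    then show ?thesis
      using overlay_integral_le_overlay[OF _ reflection_mp_automorphism, of "-s"] assms
        overlay_integral_perturbed_block[OF reflection_mp_automorphism, of "-s"]
      by simp
  qed
  \<comment> \<open>\<open>F 0\<close> enters with a negative sign, so a test map does not suffice
    here and the supremum itself is evaluated. It is that of a constant family, and the identity
    shows that the family is nonempty.\<close>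
  moreover have "F 0 = 1/8"
  proof -
    have "overlay_integral (\<lambda>x y. 1/2 + 0 * block x y) \<phi> = 1/8" if "\<phi> \<in> mp_automorphisms" for \<phi>
      unfolding overlay_integral_perturbed_block[OF that] by simp
    then have "F 0 = (SUP \<phi>\<in>mp_automorphisms. 1/8)"
      unfolding F_def overlay_block by (intro SUP_cong refl)
    then show ?thesis
      using id_mp_automorphism by (metis cSUP_const empty_iff)
  qed
  ultimately show ?thesis by linarith
qed

section \<open>Choice of the step size and contradiction\<close>

theorem proposition4p26:
  "\<exists>W\<in>graphons. \<not> (\<exists>a :: multigraph set \<Rightarrow> real.
     (\<forall>f\<in>graphons. absolutely_convergent_at a f) \<and>
     (\<forall>f\<in>graphons. density_series a f = overlay f W))"
proof (intro bexI[OF _ block_graphon] notI, elim exE conjE)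
  fix a
  assume conv: "\<forall>f\<in>graphons. absolutely_convergent_at a f"
    and eq: "\<forall>f\<in>graphons. density_series a f = overlay f block"
  define K where "K = (\<Sum>n. \<Sum>H\<in>iso_classes n. \<bar>a H\<bar>)"
  \<comment> \<open>The summand 2 gives \<open>s \<le> 1/2\<close>, and 64 makes
    \<open>32 * s * K\<close> less than 1/2, whereas comparing the two second differences forces it
    to be at least 1. The absolute value keeps the denominator positive without a sign condition on
    \<open>K\<close>.\<close>
  define s where "s = 1 / (2 + 64 * \<bar>K\<bar>)"
  have s: "0 < s" "s \<le> 1/2" by (auto simp: s_def field_simps intro: add_pos_nonneg)
  define F where "F = (\<lambda>r. overlay (\<lambda>x y. 1/2 + r * block x y) block)"
  have F: "density_series a (\<lambda>x y. 1/2 + r * block x y) = F r" if "\<bar>r\<bar> \<le> 1/2" for r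
    unfolding F_def using eq half_perturbed_block_graphon[OF that] by blast
  have one: "absolutely_convergent_at a (\<lambda>x y. 1)"
    using conv perturbed_block_graphon[of 1 0] by simp
  have bd: "\<bar>block x y\<bar> \<le> 1" for x y using block_bounds[of x y] by simp
  have "\<bar>F s + F (-s) - 2 * F 0\<bar> \<le> 8 * s\<^sup>2 * K"
    using density_series_second_difference[OF one measurable_block bd, of s] s
      F[of s] F[of "-s"] F[of 0] by (simp add: K_def)
  moreover have "s / 4 \<le> F s + F (-s) - 2 * F 0"
    unfolding F_def using s by (intro overlay_block_second_difference) auto
  ultimately have "s / 4 \<le> 8 * s\<^sup>2 * K" by linarith
  then have "s * 1 \<le> s * (32 * s * K)" by (simp add: power2_eq_square)
  then have "1 \<le> 32 * s * K" using s(1) by (simp only: mult_le_cancel_left_pos)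
  then have "2 + 64 * \<bar>K\<bar> \<le> 32 * K" by (simp add: s_def field_simps)
  then show False by linarith
qed

end
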